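(* Let the support set be a triangle $\Xi^3=\mathrm{conv}\{\hat{\xi}^1,\hat{\xi}^2,\hat{\xi}^3\}\subset\mathbb{R}^2$. The relaxed distributionally robust problem $$\min_{(z,y)\in\mathcal{S}}\Big\{ q^{T}z+b^{T}y+\sup_{\mathbb{P}\in\mathcal{D}}\mathbb{E}_{\mathbb{P}}\big[\mathcal{Q}(z,y,\tilde{\xi})\big]\Big\}$$ is equivalent to the following mixed-integer second-order cone program in the variables $(z,y)\in\mathcal{S}$ and $x^1,x^2,x^3\in\mathbb{R}^n$: $$\min_{(z,y)\in\mathcal{S},\ x^1,x^2,x^3}\ q^{T}z+b^{T}y+\sum_{\ell=1}^{3}p_{\ell}^*\,(c^{T}x^{\ell})\quad\text{s.t.}\quad Ax^{\ell}+Bz+Cy\ge d(\hat{\xi}^{\ell}),\quad \ell=1,2,3,$$ where $(p_1^*,p_2^*,p_3^* )$ are the coefficients of the unique convex combination of $\hat{\xi}^1,\hat{\xi}^2,\hat{\xi}^3$ that yields $\mu$.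
   Context: Setting. The points $\hat{\xi}^{\ell}=(\hat{\xi}^{\ell}_E,\hat{\xi}^{\ell}_N)$, $\ell=1,2,3$, are affinely independent (the triangle is nondegenerate). The mean vector $\mu=(\mu_E,\mu_N)^{T}$ belongs to $\Xi^3$. The ambiguity set $\mathcal{D}$ is the set of all probability distributions $\mathbb{P}$ of a random vector $\tilde{\xi}=(\tilde{\xi}_E,\tilde{\xi}_N)$ with $\mathbb{P}\{\tilde{\xi}\in\Xi^3\}=1$, $\mathbb{E}_{\mathbb{P}}[\tilde{\xi}_E]=\mu_E$ and $\mathbb{E}_{\mathbb{P}}[\tilde{\xi}_N]=\mu_N$. The weights are $$\begin{bmatrix}p_1^*\\ p_2^*\\ p_3^*\end{bmatrix}=\begin{bmatrix}\hat{\xi}^1_E&\hat{\xi}^2_E&\hat{\xi}^3_E\\ \hat{\xi}^1_N&\hat{\xi}^2_N&\hat{\xi}^3_N\\ 1&1&1\end{bmatrix}^{-1}\begin{bmatrix}\mu_E\\ \mu_N\\ 1\end{bmatrix}.$$ $\mathcal{S}$ is the feasible set of the first stage: a set of vectors $(z,y)$, with $z$ binary and $y$ real, described by finitely many linear and second-order-cone constraints; $q,b$ are fixed cost vectors. The second-stage (recourse) function is the optimal value of a linear program, $$\mathcal{Q}(z,y,\xi)=\min_{x\in\mathbb{R}^n}\{c^{T}x:\ Ax+Bz+Cy\ge d(\xi)\},$$ where $A,B,C$ are fixed matrices, $c$ is a fixed vector, and $d(\xi)\in\mathbb{R}^m$ is an affine function of $\xi$. For every $(z,y)\in\mathcal{S}$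 and $\xi\in\Xi^3$ this minimum exists (is finite and attained). Two minimization problems that share the variables $(z,y)$ are called equivalent if they have the same optimal value and the same set of optimal $(z,y)$ (after projecting out the additional variables, if any). *)

theory Defs
  imports "HOL-Probability.Probability"
begin

section \<open>Minimization problems\<close>

text \<open>
  A minimization problem is a feasible set together with an objective. Objectives are
  extended-real valued, so that the optimal value is always defined: it is \<open>\<infinity>\<close> for an infeasible
  problem and \<open>-\<infinity>\<close> for an unbounded one.
\<close>

definition opt_value :: "'v set \<Rightarrow> ('v \<Rightarrow> ereal) \<Rightarrow> ereal" where
  "opt_value F f = (INF v\<in>F. f v)"

definition opt_solutions :: "'v set \<Rightarrow> ('v \<Rightarrow> ereal) \<Rightarrow> 'v set" where
  "opt_solutions F f = {v. is_arg_min f (\<lambda>v. v \<in> F) v}"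

text \<open>
  The second problem may have additional variables; \<open>\<pi>\<close> projects them out.
\<close>

definition equivalent_problems ::
  "'u set \<Rightarrow> ('u \<Rightarrow> ereal) \<Rightarrow> 'v set \<Rightarrow> ('v \<Rightarrow> ereal) \<Rightarrow> ('v \<Rightarrow> 'u) \<Rightarrow> bool" where
  "equivalent_problems F f G g \<pi> \<longleftrightarrow>
     opt_value F f = opt_value G g \<and> opt_solutions F f = \<pi> ` opt_solutions G g"

section \<open>Mixed-integer second-order cone programs\<close>

text \<open>
  A linear constraint \<open>(a, \<alpha>)\<close> stands for \<open>a \<bullet> v \<le> \<alpha>\<close>. A second-order cone constraint
  \<open>(rows, g, \<gamma>)\<close> stands for \<open>\<parallel>F v + h\<parallel> \<le> g \<bullet> v + \<gamma>\<close>, where the rows of the affine map \<open>F v + h\<close>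
  are given as a list of pairs, so that different constraints may have cones of different
  dimensions.
\<close>

definition lin_constraint :: "'v::euclidean_space \<times> real \<Rightarrow> 'v \<Rightarrow> bool" where
  "lin_constraint = (\<lambda>(a, \<alpha>) v. a \<bullet> v \<le> \<alpha>)"

definition soc_constraint ::
  "('v::euclidean_space \<times> real) list \<times> 'v \<times> real \<Rightarrow> 'v \<Rightarrow> bool" where
  "soc_constraint = (\<lambda>(rows, g, \<gamma>) v.
     L2_set (\<lambda>i. fst (rows ! i) \<bullet> v + snd (rows ! i)) {..<length rows} \<le> g \<bullet> v + \<gamma>)"

definition misoc_set :: "((real^'k) \<times> 'w::euclidean_space) set \<Rightarrow> bool" where
  "misoc_set F \<longleftrightarrow> (\<exists>L K. finite L \<and> finite K \<and>
     F = {(z, w). (\<forall>i. z $ i \<in> {0, 1}) \<and>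
                  (\<forall>l\<in>L. lin_constraint l (z, w)) \<and>
                  (\<forall>k\<in>K. soc_constraint k (z, w))})"

definition misocp ::
  "((real^'k) \<times> 'w::euclidean_space) set \<Rightarrow> ((real^'k) \<times> 'w \<Rightarrow> ereal) \<Rightarrow> bool" where
  "misocp F f \<longleftrightarrow> misoc_set F \<and> (\<exists>g. \<forall>v. f v = ereal (g \<bullet> v))"

section \<open>Second stage\<close>

definition recourse_feasible ::
  "real^'n^'m \<Rightarrow> real^'k^'m \<Rightarrow> real^'l^'m \<Rightarrow> (real^2 \<Rightarrow> real^'m)
    \<Rightarrow> real^'k \<Rightarrow> real^'l \<Rightarrow> real^2 \<Rightarrow> (real^'n) set" where
  "recourse_feasible A B C d z y \<xi> = {x. A *v x + B *v z + C *v y \<ge> d \<xi>}"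

text \<open>
  The infimum is taken in the reals: it is the minimum whenever the minimum exists, and carries
  no meaning for infeasible or unbounded linear programs.
\<close>

definition recourse ::
  "real^'n \<Rightarrow> real^'n^'m \<Rightarrow> real^'k^'m \<Rightarrow> real^'l^'m \<Rightarrow> (real^2 \<Rightarrow> real^'m)
    \<Rightarrow> real^'k \<Rightarrow> real^'l \<Rightarrow> real^2 \<Rightarrow> real" where
  "recourse c A B C d z y \<xi> = (INF x\<in>recourse_feasible A B C d z y \<xi>. c \<bullet> x)"

section \<open>The distributionally robust problem\<close>

text \<open>
  The random vector is represented by its law, a Borel probability measure on the plane;
  coordinate 1 is the E-component and coordinate 2 the N-component.
\<close>

definition ambiguity_set :: "(real^2) set \<Rightarrow> real^2 \<Rightarrow> (real^2) measure set" where
  "ambiguity_set \<Xi> \<mu> = {P. prob_space P \<and> sets P = sets borel \<and> measure P \<Xi> = 1 \<and>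
     (\<integral>\<xi>. \<xi> $ 1 \<partial>P) = \<mu> $ 1 \<and> (\<integral>\<xi>. \<xi> $ 2 \<partial>P) = \<mu> $ 2}"

definition dro_objective ::
  "(real^2) set \<Rightarrow> real^2 \<Rightarrow> real^'k \<Rightarrow> real^'l \<Rightarrow> (real^'k \<Rightarrow> real^'l \<Rightarrow> real^2 \<Rightarrow> real)
    \<Rightarrow> (real^'k) \<times> (real^'l) \<Rightarrow> ereal" where
  "dro_objective \<Xi> \<mu> q b Q = (\<lambda>(z, y).
     ereal (q \<bullet> z + b \<bullet> y) + (SUP P\<in>ambiguity_set \<Xi> \<mu>. ereal (\<integral>\<xi>. Q z y \<xi> \<partial>P)))"

section \<open>The reformulation over a triangle\<close>

definition pstar :: "(3 \<Rightarrow> real^2) \<Rightarrow> real^2 \<Rightarrow> real^3" where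
  "pstar \<xi>h \<mu> =
     matrix_inv (vector [\<chi> l. \<xi>h l $ 1, \<chi> l. \<xi>h l $ 2, \<chi> l. 1] :: real^3^3)
       *v vector [\<mu> $ 1, \<mu> $ 2, 1]"

definition convex_coefficients :: "(3 \<Rightarrow> real^2) \<Rightarrow> real^2 \<Rightarrow> real^3 \<Rightarrow> bool" where
  "convex_coefficients \<xi>h \<mu> p \<longleftrightarrow>
     (\<forall>l. p $ l \<ge> 0) \<and> (\<Sum>l\<in>UNIV. p $ l) = 1 \<and> (\<Sum>l\<in>UNIV. p $ l *\<^sub>R \<xi>h l) = \<mu>"

definition ref_feasible ::
  "((real^'k) \<times> (real^'l)) set \<Rightarrow> (3 \<Rightarrow> real^2)
    \<Rightarrow> real^'n^'m \<Rightarrow> real^'k^'m \<Rightarrow> real^'l^'m \<Rightarrow> (real^2 \<Rightarrow> real^'m)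
    \<Rightarrow> ((real^'k) \<times> (real^'l) \<times> (real^'n^3)) set" where
  "ref_feasible S \<xi>h A B C d =
     {(z, y, x). (z, y) \<in> S \<and> (\<forall>l. A *v (x $ l) + B *v z + C *v y \<ge> d (\<xi>h l))}"

definition ref_objective ::
  "real^3 \<Rightarrow> real^'k \<Rightarrow> real^'l \<Rightarrow> real^'n
    \<Rightarrow> (real^'k) \<times> (real^'l) \<times> (real^'n^3) \<Rightarrow> ereal" where
  "ref_objective p q b c = (\<lambda>(z, y, x).
     ereal (q \<bullet> z + b \<bullet> y + (\<Sum>l\<in>UNIV. p $ l * (c \<bullet> (x $ l)))))"

end

(*
For fixed first-stage variables the recourse function Q is convex on the triangle, so it lies below
the affine function that interpolates its vertex values. The expectation of that interpolant
depends on the law only through its mean, which bounds every admissible expectation by the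
p*-weighted sum of the vertex values; the law with mass p*_l at vertex l attains the bound. Each
vertex value is then replaced by its linear program, whose minimum the outer minimization attains
because p* is nonnegative.

A non-integrable Q would have Bochner integral 0 and could exceed the bound. Therefore Q has to
be shown Borel on the whole plane, also where the linear program is infeasible or unbounded and Q
is a junk value; this works because its sublevel sets come from projections of closed sets, which
are sigma-compact.
*)

theory Submission
  imports Defs
begin

section \<open>Comparing minimization problems through a projection\<close>

text \<open>Projecting never raises the cost and every \<open>u\<close> lifts at equal cost, so the
  infima agree. Minimizers then lift to minimizers and project to minimizers.\<close>

lemma equivalent_problems_lift:
  assumes proj: "\<And>v. v \<in> G \<Longrightarrow> \<pi> v \<in> F \<and> f (\<pi> v) \<le> g v"
    and lift: "\<And>u. u \<in> F \<Longrightarrow> \<exists>v\<in>G. \<pi> v = u \<and> g v = f u"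
  shows "equivalent_problems F f G g \<pi>"
proof -
  have "opt_value F f = opt_value G g"
    unfolding opt_value_def
  proof (rule antisym)
    show "(INF u\<in>F. f u) \<le> (INF v\<in>G. g v)"
      using proj by (meson INF_greatest INF_lower2)
    show "(INF v\<in>G. g v) \<le> (INF u\<in>F. f u)"
      using lift by (metis INF_greatest INF_lower)
  qed
  moreover have "opt_solutions F f = \<pi> ` opt_solutions G g"
  proof (intro set_eqI iffI)
    fix u assume "u \<in> opt_solutions F f"
    then have u: "u \<in> F" "\<And>u'. u' \<in> F \<Longrightarrow> f u \<le> f u'"
      by (auto simp: opt_solutions_def is_arg_min_linorder)
    obtain v where v: "v \<in> G" "\<pi> v = u" "g v = f u"
      using lift[OF u(1)] by blast
    have "v \<in> opt_solutions G g"
      using v u(2) proj by (auto simp: opt_solutions_def is_arg_min_linorder intro: order_trans)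
    then show "u \<in> \<pi> ` opt_solutions G g"
      using v(2) by blast
  next
    fix u assume "u \<in> \<pi> ` opt_solutions G g"
    then obtain v where v: "u = \<pi> v" "v \<in> G" "\<And>v'. v' \<in> G \<Longrightarrow> g v \<le> g v'"
      by (auto simp: opt_solutions_def is_arg_min_linorder)
    have "f u \<le> f u'" if "u' \<in> F" for u'
      using lift[OF that] v proj by (metis order_trans)
    then show "u \<in> opt_solutions F f"
      using v proj by (auto simp: opt_solutions_def is_arg_min_linorder)
  qed
  ultimately show ?thesis
    by (simp add: equivalent_problems_def)
qed

section \<open>Barycentric coordinates\<close>

definition vertex_matrix :: "(3 \<Rightarrow> real^2) \<Rightarrow> real^3^3" where
  "vertex_matrix \<xi>h = vector [\<chi> l. \<xi>h l $ 1, \<chi> l. \<xi>h l $ 2, \<chi> l. 1]"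

lemma pstar_eq: "pstar \<xi>h \<mu> = matrix_inv (vertex_matrix \<xi>h) *v vector [\<mu> $ 1, \<mu> $ 2, 1]"
  by (simp add: pstar_def vertex_matrix_def)

text \<open>The last entry \<open>s\<close> is kept general: \<open>s = 1\<close> gives the
  barycentric equations, and \<open>s = 0\<close> with mean zero describes the kernel of the
  matrix.\<close>

lemma vertex_matrix_mult_eq_iff:
  "vertex_matrix \<xi>h *v p = vector [\<mu> $ 1, \<mu> $ 2, s] \<longleftrightarrow>
    (\<Sum>l\<in>UNIV. p $ l) = s \<and> (\<Sum>l\<in>UNIV. p $ l *\<^sub>R \<xi>h l) = \<mu>"
  unfolding vec_eq_iff forall_3 forall_2
  by (auto simp: vertex_matrix_def matrix_vector_mult_def mult.commute)

text \<open>A nonzero kernel vector would be an affine dependence among the vertices.\<close>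

lemma invertible_vertex_matrix:
  assumes "inj \<xi>h" "\<not> affine_dependent (range \<xi>h)"
  shows "invertible (vertex_matrix \<xi>h)"
proof -
  have "p = 0" if p: "vertex_matrix \<xi>h *v p = 0" for p
  proof -
    have "vertex_matrix \<xi>h *v p = vector [(0::real^2) $ 1, (0::real^2) $ 2, 0]"
      unfolding p vec_eq_iff forall_3 by simp
    then have sums: "(\<Sum>l\<in>UNIV. p $ l) = 0" "(\<Sum>l\<in>UNIV. p $ l *\<^sub>R \<xi>h l) = 0"
      unfolding vertex_matrix_mult_eq_iff by auto
    \<comment> \<open>\<open>U\<close> moves the coefficients from indices to vertices, the form in
      which affine dependence is stated.\<close>
    define U where "U = (\<lambda>v. p $ inv \<xi>h v)"
    have U: "U (\<xi>h l) = p $ l" for l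
      using assms(1) by (simp add: U_def)
    have "sum U (range \<xi>h) = 0" "(\<Sum>v\<in>range \<xi>h. U v *\<^sub>R v) = 0"
      using sums by (simp_all add: sum.reindex[OF assms(1)] U)
    then have "\<forall>v\<in>range \<xi>h. U v = 0"
      using assms(2) affine_dependent_explicit_finite[of "range \<xi>h"] by auto
    then show "p = 0"
      by (simp add: U vec_eq_iff)
  qed
  then show ?thesis
    by (metis invertible_left_inverse matrix_left_invertible_ker)
qed

lemma matrix_inv_mult:
  fixes M :: "'a::semiring_1^'n^'m"
  assumes "invertible M"
  shows "matrix_inv M ** M = mat 1"
  using assms unfolding invertible_def matrix_inv_def by (rule someI2_ex) simp

lemma convex_hull_range_coefficients:
  assumes "inj \<xi>h" and "\<xi> \<in> convex hull (range \<xi>h)"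
  obtains p where "convex_coefficients \<xi>h \<xi> p"
proof -
  obtain u where u: "\<forall>x\<in>range \<xi>h. 0 \<le> u x" "sum u (range \<xi>h) = 1"
      "(\<Sum>x\<in>range \<xi>h. u x *\<^sub>R x) = \<xi>"
    using assms(2) by (auto simp: convex_hull_finite)
  have "convex_coefficients \<xi>h \<xi> (\<chi> l. u (\<xi>h l))"
    using u by (simp add: convex_coefficients_def sum.reindex[OF assms(1)])
  then show thesis
    by (rule that)
qed

text \<open>Any coefficients solve an invertible linear system, which forces them to be
  \<open>pstar\<close>. Membership in the hull supplies some coefficients, so \<open>pstar\<close>
  is nonnegative without any computation of the inverse.\<close>

lemma convex_coefficients_iff_pstar:
  assumes "inj \<xi>h" "\<not> affine_dependent (range \<xi>h)" and "\<xi> \<in> convex hull (range \<xi>h)"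
  shows "convex_coefficients \<xi>h \<xi> p \<longleftrightarrow> p = pstar \<xi>h \<xi>"
proof -
  have unique: "p = pstar \<xi>h \<xi>" if "convex_coefficients \<xi>h \<xi> p" for p
  proof -
    have "vertex_matrix \<xi>h *v p = vector [\<xi> $ 1, \<xi> $ 2, 1]"
      using that unfolding vertex_matrix_mult_eq_iff by (simp add: convex_coefficients_def)
    then have "pstar \<xi>h \<xi> = (matrix_inv (vertex_matrix \<xi>h) ** vertex_matrix \<xi>h) *v p"
      unfolding pstar_eq by (metis matrix_vector_mul_assoc)
    also have "\<dots> = p"
      using invertible_vertex_matrix[OF assms(1,2)] by (simp add: matrix_inv_mult)
    finally show ?thesis ..
  qed
  then show ?thesis
    using convex_hull_range_coefficients[OF assms(1,3)] by metis
qed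

section \<open>Convex functions on a bounded convex set\<close>

text \<open>
  Reflecting \<open>x\<close> through a relative interior point \<open>g\<close> stays in the set after scaling by a fixed
  factor, so a small value at \<open>x\<close> would force a large value at the reflected point.
\<close>

lemma convex_on_bounded_below:
  fixes f :: "'a::euclidean_space \<Rightarrow> real"
  assumes f: "convex_on S f" and "bounded S" and le: "\<And>x. x \<in> S \<Longrightarrow> f x \<le> K"
  shows "\<exists>L. \<forall>x\<in>S. L \<le> f x"
proof (cases "S = {}")
  case False
  have "convex S"
    using f by (simp add: convex_on_def)
  then obtain g where "g \<in> rel_interior S"
    using False rel_interior_eq_empty by blast
  then obtain e where g: "g \<in> S" and e: "e > 0" "cball g e \<inter> affine hull S \<subseteq> S"
    by (auto simp: mem_rel_interior_cball)
  obtain r where r: "r > 0" "\<And>x. x \<in> S \<Longrightarrow> norm (g - x) \<le> r"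
  proof -
    obtain r where "\<forall>x\<in>S. dist g x \<le> r"
      using \<open>bounded S\<close> by (meson bounded_any_center)
    then have "0 < max r 1" "\<And>x. x \<in> S \<Longrightarrow> norm (g - x) \<le> max r 1"
      by (auto simp: dist_norm intro: max.coboundedI1)
    then show thesis
      by (rule that)
  qed
  \<comment> \<open>With this scaling, the reflected point \<open>y\<close> below is within
    \<open>e\<close> of \<open>g\<close> for every \<open>x\<close> in \<open>S\<close>.\<close>
  define s where "s = e / r"
  have "s > 0"
    using e(1) r(1) by (simp add: s_def)
  have "((1 + s) * f g - K) / s \<le> f x" if "x \<in> S" for x
  proof -
    define y where "y = (1 + s) *\<^sub>R g + (- s) *\<^sub>R x"
    have "norm (s *\<^sub>R (x - g)) = s * norm (g - x)"
      using \<open>s > 0\<close> by (simp add: norm_minus_commute)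
    also have "\<dots> \<le> s * r"
      using \<open>s > 0\<close> r(2)[OF that] by (simp add: mult_left_mono)
    also have "\<dots> = e"
      using r(1) by (simp add: s_def)
    finally have "norm (s *\<^sub>R (x - g)) \<le> e" .
    moreover have "g - y = s *\<^sub>R (x - g)"
      by (simp add: y_def algebra_simps)
    ultimately have "y \<in> cball g e"
      by (simp add: dist_norm)
    moreover have "y \<in> affine hull S"
      unfolding y_def using g that
      by (intro mem_affine affine_affine_hull hull_inc) auto
    ultimately have "y \<in> S"
      using e(2) by blast
    \<comment> \<open>Solved for \<open>g\<close>, the definition of \<open>y\<close> makes
      \<open>g\<close> a convex combination of \<open>x\<close> and \<open>y\<close>.\<close>
    have "(s / (1 + s)) *\<^sub>R x + (1 / (1 + s)) *\<^sub>R y = (1 / (1 + s)) *\<^sub>R (s *\<^sub>R x + y)"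
      by (simp add: scaleR_add_right)
    also have "s *\<^sub>R x + y = (1 + s) *\<^sub>R g"
      by (simp add: y_def)
    also have "(1 / (1 + s)) *\<^sub>R \<dots> = g"
      using \<open>s > 0\<close> by simp
    finally have g_eq: "(s / (1 + s)) *\<^sub>R x + (1 / (1 + s)) *\<^sub>R y = g" .
    have "s / (1 + s) + 1 / (1 + s) = 1"
      using \<open>s > 0\<close> by (simp add: field_simps)
    moreover have "0 \<le> s / (1 + s)" "0 \<le> 1 / (1 + s)"
      using \<open>s > 0\<close> by auto
    ultimately have "f g \<le> s / (1 + s) * f x + 1 / (1 + s) * f y"
      using f that \<open>y \<in> S\<close> unfolding convex_on_def by (subst g_eq[symmetric]) blast
    also have "\<dots> \<le> s / (1 + s) * f x + 1 / (1 + s) * K"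
      using le[OF \<open>y \<in> S\<close>] \<open>s > 0\<close> by (simp add: divide_right_mono)
    also have "\<dots> = (s * f x + K) / (1 + s)"
      by (simp add: add_divide_distrib)
    finally show ?thesis
      using \<open>s > 0\<close> by (simp add: field_simps)
  qed
  then show ?thesis
    by blast
qed auto

text \<open>The values on \<open>V\<close> bound \<open>f\<close> from above, and the previous lemma
  then bounds it from below. Compactness alone would not suffice, since a convex function may jump
  at the boundary.\<close>

lemma convex_on_hull_finite_bounded:
  fixes f :: "'a::euclidean_space \<Rightarrow> real"
  assumes "finite V" and f: "convex_on (convex hull V) f"
  shows "\<exists>K. \<forall>x\<in>convex hull V. \<bar>f x\<bar> \<le> K"
proof -
  define U where "U = (\<Sum>v\<in>V. \<bar>f v\<bar>)"
  have "\<forall>v\<in>V. f v \<le> U"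
    unfolding U_def by (meson abs_ge_self abs_ge_zero assms(1) member_le_sum order_trans)
  then have U: "\<forall>x\<in>convex hull V. f x \<le> U"
    by (rule convex_on_convex_hull_bound[OF f])
  moreover obtain L where "\<forall>x\<in>convex hull V. L \<le> f x"
    using convex_on_bounded_below[OF f] U \<open>finite V\<close>
    by (meson bounded_convex_hull finite_imp_bounded)
  ultimately show ?thesis
    by (intro exI[of _ "max U (- L)"]) (force simp: abs_le_iff)
qed

section \<open>The worst-case expectation of a convex function over a triangle\<close>

lemma ambiguity_setD:
  assumes P: "P \<in> ambiguity_set \<Xi> \<mu>" and "\<Xi> \<in> sets borel"
  shows "prob_space P" "sets P = sets borel" "AE \<xi> in P. \<xi> \<in> \<Xi>" "(\<integral>\<xi>. \<xi> $ i \<partial>P) = \<mu> $ i"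
proof -
  show *: "prob_space P" "sets P = sets borel"
    using P by (auto simp: ambiguity_set_def)
  then show "AE \<xi> in P. \<xi> \<in> \<Xi>"
    using P assms(2) by (simp add: ambiguity_set_def prob_space.AE_in_set_eq_1)
  show "(\<integral>\<xi>. \<xi> $ i \<partial>P) = \<mu> $ i"
    using P exhaust_2[of i] by (auto simp: ambiguity_set_def)
qed

text \<open>Almost surely \<open>f\<close> lies below its vertex interpolant, whose coefficients are
  the barycentric coordinates of \<xi>. These are affine in \<xi>, so taking expectations replaces
  \<xi> by \<mu>.\<close>

lemma expectation_le_barycentric:
  fixes f :: "real^2 \<Rightarrow> real"
  assumes nondeg: "inj \<xi>h" "\<not> affine_dependent (range \<xi>h)"
    and f: "convex_on (convex hull (range \<xi>h)) f" "f \<in> borel_measurable borel"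
    and P: "P \<in> ambiguity_set (convex hull (range \<xi>h)) \<mu>"
  shows "(\<integral>\<xi>. f \<xi> \<partial>P) \<le> (\<Sum>l\<in>UNIV. pstar \<xi>h \<mu> $ l * f (\<xi>h l))"
proof -
  let ?T = "convex hull (range \<xi>h)"
  have "compact ?T"
    by (simp add: compact_convex_hull finite_imp_compact)
  then have "?T \<in> sets borel"
    by (simp add: borel_closed compact_imp_closed)
  note P = ambiguity_setD[OF P this]
  interpret prob_space P by (rule P(1))
  note [measurable_cong] = P(2)
  note [measurable] = f(2)
  obtain K where K: "\<And>\<xi>. \<xi> \<in> ?T \<Longrightarrow> norm \<xi> \<le> K"
    using \<open>compact ?T\<close> by (meson bounded_iff compact_imp_bounded)
  obtain K' where K': "\<And>\<xi>. \<xi> \<in> ?T \<Longrightarrow> \<bar>f \<xi>\<bar> \<le> K'"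
    using convex_on_hull_finite_bounded[OF _ f(1)] by auto
  have coord: "integrable P (\<lambda>\<xi>. \<xi> $ i)" for i :: 2
  proof (rule integrable_const_bound[of _ K])
    show "AE \<xi> in P. norm (\<xi> $ i) \<le> K"
      using P(3) by eventually_elim (metis K component_le_norm_cart order_trans real_norm_def)
  qed measurable
  \<comment> \<open>Integrability rules out the default value 0 of the integral; it follows from
    measurability and the bound on the triangle.\<close>
  have int_f: "integrable P f"
    by (rule integrable_const_bound[of _ K']) (use P(3) K' in \<open>auto elim!: eventually_mono\<close>)
  \<comment> \<open>The third column of the inverse meets the constant entry 1 and gives the
    constant term of this affine function.\<close>
  have pstar: "pstar \<xi>h \<xi> $ l = matrix_inv (vertex_matrix \<xi>h) $ l $ 1 * \<xi> $ 1
      + matrix_inv (vertex_matrix \<xi>h) $ l $ 2 * \<xi> $ 2 + matrix_inv (vertex_matrix \<xi>h) $ l $ 3"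
    for \<xi> l
    by (simp add: pstar_eq matrix_vector_mult_def sum_3)
  have int_p: "integrable P (\<lambda>\<xi>. pstar \<xi>h \<xi> $ l)" for l
    unfolding pstar by (intro Bochner_Integration.integrable_add integrable_mult_right coord) simp
  have exp_p: "(\<integral>\<xi>. pstar \<xi>h \<xi> $ l \<partial>P) = pstar \<xi>h \<mu> $ l" for l
    unfolding pstar using coord by (simp add: P(4) prob_space)
  have "(\<integral>\<xi>. f \<xi> \<partial>P) \<le> (\<integral>\<xi>. (\<Sum>l\<in>UNIV. pstar \<xi>h \<xi> $ l * f (\<xi>h l)) \<partial>P)"
  proof (rule integral_mono_AE[OF int_f])
    show "AE \<xi> in P. f \<xi> \<le> (\<Sum>l\<in>UNIV. pstar \<xi>h \<xi> $ l * f (\<xi>h l))"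
      using P(3)
    proof eventually_elim
      case (elim \<xi>)
      then have "convex_coefficients \<xi>h \<xi> (pstar \<xi>h \<xi>)"
        using convex_coefficients_iff_pstar[OF nondeg] by blast
      then show ?case
        using convex_on_sum[OF _ _ f(1), of UNIV "\<lambda>l. pstar \<xi>h \<xi> $ l" \<xi>h]
        by (simp add: convex_coefficients_def hull_inc)
    qed
  qed (simp add: int_p)
  also have "\<dots> = (\<Sum>l\<in>UNIV. pstar \<xi>h \<mu> $ l * f (\<xi>h l))"
    by (simp add: int_p exp_p)
  finally show ?thesis .
qed

text \<open>The law is the image under \<open>\<xi>h\<close> of the distribution \<open>p\<close> on
  the three indices, so its expectations are finite sums.\<close>

lemma convex_coefficients_law:
  assumes p: "convex_coefficients \<xi>h \<mu> p"
  shows "\<exists>P\<in>ambiguity_set (convex hull (range \<xi>h)) \<mu>. \<forall>f\<in>borel_measurable borel.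
    (\<integral>\<xi>. f \<xi> \<partial>P) = (\<Sum>l\<in>UNIV. p $ l * f (\<xi>h l) :: real)"
proof -
  have nonneg: "\<And>l. p $ l \<ge> 0" and sum: "(\<Sum>l\<in>UNIV. p $ l) = 1"
    and bary: "(\<Sum>l\<in>UNIV. p $ l *\<^sub>R \<xi>h l) = \<mu>"
    using p by (auto simp: convex_coefficients_def)
  define w where "w = embed_pmf (\<lambda>l. p $ l)"
  have w: "pmf w l = p $ l" for l
    unfolding w_def
  proof (rule pmf_embed_pmf)
    show "(\<integral>\<^sup>+ l. ennreal (p $ l) \<partial>count_space UNIV) = 1"
      using nonneg sum by (simp add: nn_integral_count_space_finite sum_ennreal)
  qed (rule nonneg)
  define P where "P = distr (measure_pmf w) borel \<xi>h"
  have [measurable]: "\<xi>h \<in> measurable (measure_pmf w) borel"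
    by simp
  have exp: "(\<integral>\<xi>. f \<xi> \<partial>P) = (\<Sum>l\<in>UNIV. p $ l * f (\<xi>h l))"
    if "f \<in> borel_measurable borel" for f :: "real^2 \<Rightarrow> real"
    using that by (simp add: P_def integral_distr integral_measure_pmf[of UNIV] w)
  have coord: "(\<integral>\<xi>. \<xi> $ i \<partial>P) = \<mu> $ i" for i
    \<comment> \<open>The coordinate functions are themselves admissible choices of \<open>f\<close>
      in \<open>exp\<close>.\<close>
    by (subst exp) (auto simp: bary[symmetric])
  have "convex hull (range \<xi>h) \<in> sets borel"
    by (simp add: borel_closed compact_convex_hull compact_imp_closed finite_imp_compact)
  then have "measure P (convex hull (range \<xi>h)) = measure w (\<xi>h -` (convex hull (range \<xi>h)))"
    unfolding P_def by (subst measure_distr) auto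
  also have "\<xi>h -` (convex hull (range \<xi>h)) = UNIV"
    by (auto simp: hull_inc)
  finally have "measure P (convex hull (range \<xi>h)) = 1"
    by simp
  then have "P \<in> ambiguity_set (convex hull (range \<xi>h)) \<mu>"
    using coord by (auto simp: ambiguity_set_def P_def intro: measure_pmf.prob_space_distr)
  then show ?thesis
    using exp by blast
qed

lemma worst_case_expectation_triangle:
  fixes f :: "real^2 \<Rightarrow> real"
  assumes nondeg: "inj \<xi>h" "\<not> affine_dependent (range \<xi>h)"
    and mean: "\<mu> \<in> convex hull (range \<xi>h)"
    and f: "convex_on (convex hull (range \<xi>h)) f" "f \<in> borel_measurable borel"
  shows "(SUP P\<in>ambiguity_set (convex hull (range \<xi>h)) \<mu>. ereal (\<integral>\<xi>. f \<xi> \<partial>P)) =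
    ereal (\<Sum>l\<in>UNIV. pstar \<xi>h \<mu> $ l * f (\<xi>h l))"
proof (rule antisym)
  show "(SUP P\<in>ambiguity_set (convex hull (range \<xi>h)) \<mu>. ereal (\<integral>\<xi>. f \<xi> \<partial>P)) \<le>
      ereal (\<Sum>l\<in>UNIV. pstar \<xi>h \<mu> $ l * f (\<xi>h l))"
    using expectation_le_barycentric[OF nondeg f] by (auto intro: SUP_least)
  have "convex_coefficients \<xi>h \<mu> (pstar \<xi>h \<mu>)"
    by (simp add: convex_coefficients_iff_pstar[OF nondeg mean])
  then obtain P where P: "P \<in> ambiguity_set (convex hull (range \<xi>h)) \<mu>"
      "(\<integral>\<xi>. f \<xi> \<partial>P) = (\<Sum>l\<in>UNIV. pstar \<xi>h \<mu> $ l * f (\<xi>h l))"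
    using convex_coefficients_law f(2) by blast
  then show "ereal (\<Sum>l\<in>UNIV. pstar \<xi>h \<mu> $ l * f (\<xi>h l)) \<le>
      (SUP P\<in>ambiguity_set (convex hull (range \<xi>h)) \<mu>. ereal (\<integral>\<xi>. f \<xi> \<partial>P))"
    using SUP_upper[OF P(1), of "\<lambda>P. ereal (\<integral>\<xi>. f \<xi> \<partial>P)"] by (simp add: P(2))
qed

section \<open>Measurability of the recourse function\<close>

text \<open>A projection of a closed set need not be closed, but cutting with balls writes it as a
  countable union of compact images.\<close>

lemma borel_fst_closed:
  fixes F :: "('a::euclidean_space \<times> 'b::euclidean_space) set"
  assumes "closed F"
  shows "fst ` F \<in> sets borel"
proof -
  have "F = (\<Union>n. F \<inter> cball 0 (real n))"
    by (auto simp: real_arch_simple)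
  then have "fst ` F = (\<Union>n. fst ` (F \<inter> cball 0 (real n)))"
    by (metis image_UN)
  moreover have "compact (fst ` (F \<inter> cball 0 (real n)))" for n
    using assms by (intro compact_continuous_image continuous_intros) (simp add: closed_Int_compact)
  ultimately show ?thesis
    by (metis borel_compact range_subsetD sets.countable_UN image_subsetI)
qed

text \<open>On sets that are unbounded below, \<open>Inf\<close> is an unspecified real, but always the same one.\<close>

lemma Inf_not_bdd_below:
  fixes X :: "real set"
  assumes "\<not> bdd_below X"
  shows "Inf X = Inf UNIV"
proof -
  \<comment> \<open>\<open>Inf\<close> unfolds to minus the least upper bound of the negated set.
    Without any upper bound, the defining predicate is constantly false for both sets, so the two
    terms coincide.\<close>
  have "(\<forall>x\<in>uminus ` X. x \<le> z) = False" for z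
    using assms by (auto simp: bdd_below_def) (meson minus_le_iff)
  moreover have "(\<forall>x\<in>uminus ` UNIV. x \<le> z) = False" for z :: real
    using gt_ex[of z] by (simp add: surj_uminus not_le)
  ultimately show ?thesis
    by (simp only: Inf_real_def Sup_real_def)
qed

text \<open>Emptiness, boundedness below and strict inequality are all countable combinations of the
  non-strict sublevel conditions. The non-strict form is the one that yields closed sets for a
  linear program.\<close>

lemma borel_measurable_Inf_sublevel:
  fixes G :: "'a \<Rightarrow> real set"
  assumes sub [measurable]: "\<And>t. Measurable.pred M (\<lambda>a. \<exists>s\<in>G a. s \<le> t)"
  shows "(\<lambda>a. Inf (G a)) \<in> borel_measurable M"
proof (rule borel_measurableI_less)
  fix t :: real
  have empty: "G a = {} \<longleftrightarrow> \<not> (\<exists>n::nat. \<exists>s\<in>G a. s \<le> real n)" for a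
    using real_arch_simple by blast
  have bdd: "bdd_below (G a) \<longleftrightarrow> \<not> (\<forall>n::nat. \<exists>s\<in>G a. s \<le> - real n)" for a
  proof
    assume "bdd_below (G a)"
    then obtain m where m: "\<And>s. s \<in> G a \<Longrightarrow> m \<le> s"
      by (auto simp: bdd_below_def)
    obtain n :: nat where "- m < real n"
      using reals_Archimedean2 by blast
    then show "\<not> (\<forall>n::nat. \<exists>s\<in>G a. s \<le> - real n)"
      using m by (metis dual_order.trans minus_less_iff not_le)
  next
    assume "\<not> (\<forall>n::nat. \<exists>s\<in>G a. s \<le> - real n)"
    then show "bdd_below (G a)"
      by (auto simp: bdd_below_def) (meson linear)
  qed
  have strict: "(\<exists>s\<in>G a. s < t) \<longleftrightarrow> (\<exists>n::nat. \<exists>s\<in>G a. s \<le> t - 1 / Suc n)" for a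
  proof
    assume "\<exists>s\<in>G a. s < t"
    then obtain s where s: "s \<in> G a" "s < t"
      by blast
    then obtain n :: nat where "1 / Suc n < t - s"
      by (metis diff_gt_0_iff_gt nat_approx_posE)
    then show "\<exists>n::nat. \<exists>s\<in>G a. s \<le> t - 1 / Suc n"
      using s(1) by (intro exI[of _ n] bexI[of _ s]) auto
  next
    assume "\<exists>n::nat. \<exists>s\<in>G a. s \<le> t - 1 / Suc n"
    then obtain n :: nat and s where "s \<in> G a" "s \<le> t - 1 / Suc n"
      by blast
    moreover have "1 / Suc n > (0::real)"
      by simp
    ultimately show "\<exists>s\<in>G a. s < t"
      by (intro bexI[of _ s]) linarith+
  qed
  \<comment> \<open>In the empty and the unbounded case \<open>Inf\<close> is a fixed real, so the
    condition no longer depends on \<open>a\<close>.\<close>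
  have "Inf (G a) < t \<longleftrightarrow>
      (if G a = {} then Inf {} < t
       else if bdd_below (G a) then \<exists>s\<in>G a. s < t
       else Inf (UNIV :: real set) < t)" for a
    by (auto simp: cInf_less_iff dest: Inf_not_bdd_below)
  then have eq: "(\<lambda>a. Inf (G a) < t) = (\<lambda>a.
      if \<not> (\<exists>n::nat. \<exists>s\<in>G a. s \<le> real n) then Inf {} < t
      else if \<not> (\<forall>n::nat. \<exists>s\<in>G a. s \<le> - real n) then \<exists>n::nat. \<exists>s\<in>G a. s \<le> t - 1 / Suc n
      else Inf (UNIV :: real set) < t)"
    by (simp only: empty bdd strict not_not)
  have "Measurable.pred M (\<lambda>a. Inf (G a) < t)"
    unfolding eq by measurable
  then show "{a \<in> space M. Inf (G a) < t} \<in> sets M"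
    by (simp only: pred_def)
qed

lemma borel_measurable_recourse:
  assumes "continuous_on UNIV d"
  shows "recourse c A B C d z y \<in> borel_measurable borel"
proof -
  have "Measurable.pred borel
      (\<lambda>\<xi>. \<exists>s\<in>(\<bullet>) c ` recourse_feasible A B C d z y \<xi>. s \<le> t)" for t
  proof -
    \<comment> \<open>Continuity of \<open>d\<close> makes \<open>F\<close> closed in the joint
      space, and projecting out \<open>x\<close> gives the sublevel condition at
      \<open>t\<close>.\<close>
    define F where "F = {(\<xi>, x). d \<xi> \<le> A *v x + B *v z + C *v y \<and> c \<bullet> x \<le> t}"
    have "continuous_on UNIV (\<lambda>v :: _ \<times> _. A *v snd v)"
      by (intro continuous_on_compose2[OF matrix_vector_mult_linear_continuous_on]
          continuous_intros) auto
    then have "closed {v. d (fst v) $ i \<le> (A *v snd v + B *v z + C *v y) $ i}" for i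
      by (intro closed_Collect_le continuous_intros continuous_on_compose2[OF assms]) auto
    moreover have "closed {v. c \<bullet> snd v \<le> t}"
      by (intro closed_Collect_le continuous_intros)
    moreover have "F = (\<Inter>i. {v. d (fst v) $ i \<le> (A *v snd v + B *v z + C *v y) $ i})
        \<inter> {v. c \<bullet> snd v \<le> t}"
      by (auto simp: F_def less_eq_vec_def)
    ultimately have "closed F"
      by auto
    then have "fst ` F \<in> sets borel"
      by (rule borel_fst_closed)
    also have "fst ` F = {\<xi>. \<exists>s\<in>(\<bullet>) c ` recourse_feasible A B C d z y \<xi>. s \<le> t}"
      by (force simp: F_def recourse_feasible_def)
    finally show ?thesis
      by (simp add: pred_def)
  qed
  then have "(\<lambda>\<xi>. INF x\<in>recourse_feasible A B C d z y \<xi>. c \<bullet> x) \<in> borel_measurable borel"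
    by (rule borel_measurable_Inf_sublevel)
  then show ?thesis
    by (simp add: recourse_def[abs_def])
qed

section \<open>Convexity of the recourse function\<close>

lemma recourse_eq_arg_min:
  assumes "is_arg_min (\<lambda>x. c \<bullet> x) (\<lambda>x. x \<in> recourse_feasible A B C d z y \<xi>) x"
  shows "recourse c A B C d z y \<xi> = c \<bullet> x"
  using assms unfolding recourse_def is_arg_min_linorder by (intro cInf_eq_minimum) auto

text \<open>Existence of a minimizer is what makes the real infimum a genuine lower bound.\<close>

lemma recourse_le:
  assumes "\<exists>x. is_arg_min (\<lambda>x. c \<bullet> x) (\<lambda>x. x \<in> recourse_feasible A B C d z y \<xi>) x"
    and "x \<in> recourse_feasible A B C d z y \<xi>"
  shows "recourse c A B C d z y \<xi> \<le> c \<bullet> x"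
  using assms recourse_eq_arg_min by (metis is_arg_min_linorder)

text \<open>Since \<open>d\<close> is affine, the convex combination of minimizers for two scenarios
  is feasible for the combined scenario, at the combined cost.\<close>

lemma convex_on_recourse:
  assumes "linear D" and d: "\<And>\<xi>. d \<xi> = D \<xi> + d0" and "convex T"
    and min: "\<And>\<xi>. \<xi> \<in> T \<Longrightarrow>
      \<exists>x. is_arg_min (\<lambda>x. c \<bullet> x) (\<lambda>x. x \<in> recourse_feasible A B C d z y \<xi>) x"
  shows "convex_on T (recourse c A B C d z y)"
  unfolding convex_on_def
proof (intro conjI ballI allI impI \<open>convex T\<close>)
  fix \<xi> \<eta> and u v :: real
  assume T: "\<xi> \<in> T" "\<eta> \<in> T" and uv: "0 \<le> u" "0 \<le> v" "u + v = 1"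
  let ?Q = "recourse c A B C d z y" and ?R = "recourse_feasible A B C d z y"
  let ?b = "B *v z + C *v y"
  obtain x x' where x: "x \<in> ?R \<xi>" "?Q \<xi> = c \<bullet> x" and x': "x' \<in> ?R \<eta>" "?Q \<eta> = c \<bullet> x'"
    using min[OF T(1)] min[OF T(2)] recourse_eq_arg_min by (metis is_arg_min_def)
  \<comment> \<open>The factor \<open>u + v\<close>, equal to 1, distributes the constant
    \<open>d0\<close> over both scenarios; the same device merges \<open>?b\<close> below.\<close>
  have "d (u *\<^sub>R \<xi> + v *\<^sub>R \<eta>) = u *\<^sub>R D \<xi> + v *\<^sub>R D \<eta> + (u + v) *\<^sub>R d0"
    by (simp add: d uv(3) linear_add[OF \<open>linear D\<close>] linear_scale[OF \<open>linear D\<close>])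
  also have "\<dots> = u *\<^sub>R d \<xi> + v *\<^sub>R d \<eta>"
    by (simp add: d algebra_simps)
  also have "\<dots> \<le> u *\<^sub>R (A *v x + ?b) + v *\<^sub>R (A *v x' + ?b)"
    using x(1) x'(1) uv
    by (intro add_mono scaleR_left_mono) (auto simp: recourse_feasible_def add.assoc)
  also have "\<dots> = A *v (u *\<^sub>R x + v *\<^sub>R x') + (u + v) *\<^sub>R ?b"
    by (simp add: matrix_vector_right_distrib matrix_vector_mult_scaleR scaleR_add_right
        scaleR_add_left)
  also have "\<dots> = A *v (u *\<^sub>R x + v *\<^sub>R x') + B *v z + C *v y"
    by (simp add: uv(3) add.assoc)
  finally have "u *\<^sub>R x + v *\<^sub>R x' \<in> ?R (u *\<^sub>R \<xi> + v *\<^sub>R \<eta>)"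
    by (simp add: recourse_feasible_def)
  moreover have "u *\<^sub>R \<xi> + v *\<^sub>R \<eta> \<in> T"
    using \<open>convex T\<close> T uv by (simp add: convex_def)
  ultimately have "?Q (u *\<^sub>R \<xi> + v *\<^sub>R \<eta>) \<le> c \<bullet> (u *\<^sub>R x + v *\<^sub>R x')"
    by (intro recourse_le min)
  also have "\<dots> = u * ?Q \<xi> + v * ?Q \<eta>"
    by (simp add: x(2) x'(2) inner_add_right)
  finally show "?Q (u *\<^sub>R \<xi> + v *\<^sub>R \<eta>) \<le> u * ?Q \<xi> + v * ?Q \<eta>" .
qed

section \<open>The reformulation as a mixed-integer second-order cone program\<close>

text \<open>Padding each coefficient vector with a zero block for \<open>x\<close> leaves all inner
  products, and hence all constraints, unchanged.\<close>

lemma misoc_set_lift: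
  fixes S :: "((real^'k) \<times> 'w::euclidean_space) set"
  assumes "misoc_set S"
  shows "misoc_set {(z, y, x :: 'x::euclidean_space). (z, y) \<in> S}"
proof -
  obtain L K where fin: "finite L" "finite K" and S: "S = {(z, w). (\<forall>i. z $ i \<in> {0, 1}) \<and>
      (\<forall>l\<in>L. lin_constraint l (z, w)) \<and> (\<forall>k\<in>K. soc_constraint k (z, w))}"
    using assms by (auto simp: misoc_set_def)
  define e :: "(real^'k) \<times> 'w \<Rightarrow> (real^'k) \<times> 'w \<times> 'x" where "e = (\<lambda>(a, a'). (a, a', 0))"
  have e: "e a \<bullet> (z, y, x) = a \<bullet> (z, y)" for a z y x
    by (cases a) (simp add: e_def)
  define L' where "L' = (\<lambda>(a, \<alpha>). (e a, \<alpha> :: real)) ` L"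
  define K' where
    "K' = (\<lambda>(rows, g, \<gamma>). (map (\<lambda>(a, \<alpha>). (e a, \<alpha> :: real)) rows, e g, \<gamma> :: real)) ` K"
  have lin: "lin_constraint (e a, \<alpha>) (z, y, x) \<longleftrightarrow> lin_constraint (a, \<alpha>) (z, y)" for a \<alpha> z y x
    by (simp add: lin_constraint_def e)
  have soc: "soc_constraint (map (\<lambda>(a, \<alpha>). (e a, \<alpha>)) rows, e g, \<gamma>) (z, y, x) \<longleftrightarrow>
      soc_constraint (rows, g, \<gamma>) (z, y)" for rows g \<gamma> z y x
  proof -
    have "L2_set (\<lambda>i. fst (map (\<lambda>(a, \<alpha>). (e a, \<alpha>)) rows ! i) \<bullet> (z, y, x)
          + snd (map (\<lambda>(a, \<alpha>). (e a, \<alpha>)) rows ! i)) {..<length rows}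
        = L2_set (\<lambda>i. fst (rows ! i) \<bullet> (z, y) + snd (rows ! i)) {..<length rows}"
      by (intro L2_set_cong) (auto simp: case_prod_beta e)
    then show ?thesis
      by (simp add: soc_constraint_def e)
  qed
  have "{(z, y, x :: 'x). (z, y) \<in> S} = {(z, w). (\<forall>i. z $ i \<in> {0, 1}) \<and>
      (\<forall>l\<in>L'. lin_constraint l (z, w)) \<and> (\<forall>k\<in>K'. soc_constraint k (z, w))}"
    unfolding S L'_def K'_def by (force simp: lin soc split: prod.splits)
  moreover have "finite L'" "finite K'"
    using fin by (auto simp: L'_def K'_def)
  ultimately show ?thesis
    unfolding misoc_set_def by blast
qed

lemma misoc_set_Int_linear:
  assumes "misoc_set F" and "finite L'"
  shows "misoc_set {v \<in> F. \<forall>l\<in>L'. lin_constraint l v}"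
proof -
  obtain L K where fin: "finite L" "finite K" and F: "F = {(z, w). (\<forall>i. z $ i \<in> {0, 1}) \<and>
      (\<forall>l\<in>L. lin_constraint l (z, w)) \<and> (\<forall>k\<in>K. soc_constraint k (z, w))}"
    using assms(1) by (auto simp: misoc_set_def)
  have "{v \<in> F. \<forall>l\<in>L'. lin_constraint l v} = {(z, w). (\<forall>i. z $ i \<in> {0, 1}) \<and>
      (\<forall>l\<in>L \<union> L'. lin_constraint l (z, w)) \<and> (\<forall>k\<in>K. soc_constraint k (z, w))}"
    unfolding F by auto
  moreover have "finite (L \<union> L')"
    using fin(1) assms(2) by simp
  ultimately show ?thesis
    unfolding misoc_set_def using fin(2)
    by (intro exI[of _ "L \<union> L'"] exI[of _ K] conjI)
qed

lemma misocp_reformulation: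
  fixes A :: "real^'n^'m" and B :: "real^'k^'m" and C :: "real^'l^'m"
  assumes "misoc_set S"
  shows "misocp (ref_feasible S \<xi>h A B C d) (ref_objective p q b c)"
proof -
  \<comment> \<open>One constraint per vertex and matrix row. Signs are reversed to fit the form
    \<open>a \<bullet> v \<le> \<alpha>\<close>, and \<open>axis l\<close> puts the row of
    \<open>A\<close> into block \<open>l\<close> of \<open>x\<close>.\<close>
  define con :: "3 \<times> 'm \<Rightarrow> ((real^'k) \<times> (real^'l) \<times> (real^'n^3)) \<times> real" where
    "con = (\<lambda>(l, i). ((- B $ i, - C $ i, - axis l (A $ i)), - (d (\<xi>h l) $ i)))"
  have con: "lin_constraint (con (l, i)) (z, y, x) \<longleftrightarrow>
      d (\<xi>h l) $ i \<le> (A *v (x $ l) + B *v z + C *v y) $ i" for l i z y x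
    by (auto simp: lin_constraint_def con_def inner_axis' matrix_vector_mul_component)
  have "ref_feasible S \<xi>h A B C d =
      {v \<in> {(z, y, x). (z, y) \<in> S}. \<forall>l\<in>range con. lin_constraint l v}"
    by (auto simp: ref_feasible_def less_eq_vec_def con)
  moreover have "misoc_set \<dots>"
    by (intro misoc_set_Int_linear misoc_set_lift assms) simp
  moreover have "ref_objective p q b c v = ereal ((q, b, \<chi> l. p $ l *\<^sub>R c) \<bullet> v)" for v
    by (cases v) (simp add: ref_objective_def inner_vec_def[of "\<chi> l. p $ l *\<^sub>R c"])
  ultimately show ?thesis
    by (auto simp: misocp_def)
qed

theorem mainTheorem5:
  fixes \<xi>h :: "3 \<Rightarrow> real^2" and \<mu> :: "real^2"
    and S :: "((real^'k) \<times> (real^'l)) set"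
    and q :: "real^'k" and b :: "real^'l" and c :: "real^'n"
    and A :: "real^'n^'m" and B :: "real^'k^'m" and C :: "real^'l^'m"
    and d :: "real^2 \<Rightarrow> real^'m"
  assumes nondegenerate: "inj \<xi>h" "\<not> affine_dependent (range \<xi>h)"
    and mean: "\<mu> \<in> convex hull (range \<xi>h)"
    and first_stage: "misoc_set S"
    and d_affine: "\<exists>D d0. linear D \<and> (\<forall>\<xi>. d \<xi> = D \<xi> + d0)"
    and recourse_min: "\<And>z y \<xi>. (z, y) \<in> S \<Longrightarrow> \<xi> \<in> convex hull (range \<xi>h) \<Longrightarrow>
      \<exists>x. is_arg_min (\<lambda>x. c \<bullet> x) (\<lambda>x. x \<in> recourse_feasible A B C d z y \<xi>) x"
  shows "(\<forall>p. convex_coefficients \<xi>h \<mu> p \<longleftrightarrow> p = pstar \<xi>h \<mu>) \<and>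
    misocp (ref_feasible S \<xi>h A B C d) (ref_objective (pstar \<xi>h \<mu>) q b c) \<and>
    equivalent_problems
      S (dro_objective (convex hull (range \<xi>h)) \<mu> q b (recourse c A B C d))
      (ref_feasible S \<xi>h A B C d) (ref_objective (pstar \<xi>h \<mu>) q b c)
      (\<lambda>(z, y, x). (z, y))"
proof (intro conjI allI)
  let ?T = "convex hull (range \<xi>h)" and ?Q = "recourse c A B C d" and ?p = "pstar \<xi>h \<mu>"
  note coeffs = convex_coefficients_iff_pstar[OF nondegenerate mean]
  show "convex_coefficients \<xi>h \<mu> p \<longleftrightarrow> p = ?p" for p
    by (rule coeffs)
  show "misocp (ref_feasible S \<xi>h A B C d) (ref_objective ?p q b c)"
    by (rule misocp_reformulation[OF first_stage])
  obtain D d0 where D: "linear D" and d: "\<And>\<xi>. d \<xi> = D \<xi> + d0"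
    using d_affine by blast
  have "continuous_on UNIV d"
    using D by (simp add: d[abs_def] continuous_on_add linear_continuous_on linear_conv_bounded_linear)
  then have meas: "?Q z y \<in> borel_measurable borel" for z y
    by (rule borel_measurable_recourse)
  have vertex: "\<xi>h l \<in> ?T" for l
    by (simp add: hull_inc)
  have p_nonneg: "?p $ l \<ge> 0" for l
    using coeffs by (auto simp: convex_coefficients_def)
  \<comment> \<open>The inner supremum collapses to a weighted sum of vertex values, the form that
    is compared with \<open>ref_objective\<close> below.\<close>
  have dro: "dro_objective ?T \<mu> q b ?Q (z, y) =
      ereal (q \<bullet> z + b \<bullet> y + (\<Sum>l\<in>UNIV. ?p $ l * ?Q z y (\<xi>h l)))" if "(z, y) \<in> S" for z y
  proof -
    have "convex_on ?T (?Q z y)"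
      using recourse_min[OF that] by (intro convex_on_recourse[OF D d]) auto
    then show ?thesis
      using worst_case_expectation_triangle[OF nondegenerate mean _ meas]
      by (simp add: dro_objective_def)
  qed
  show "equivalent_problems S (dro_objective ?T \<mu> q b ?Q)
      (ref_feasible S \<xi>h A B C d) (ref_objective ?p q b c) (\<lambda>(z, y, x). (z, y))"
  proof (rule equivalent_problems_lift)
    fix v assume "v \<in> ref_feasible S \<xi>h A B C d"
    then obtain z y x where v: "v = (z, y, x)" and S: "(z, y) \<in> S"
      and x: "\<And>l. x $ l \<in> recourse_feasible A B C d z y (\<xi>h l)"
      by (auto simp: ref_feasible_def recourse_feasible_def)
    \<comment> \<open>Nonnegative weights preserve the bound of the optimal value by the cost of any
      feasible \<open>x\<close>.\<close>
    have "?p $ l * ?Q z y (\<xi>h l) \<le> ?p $ l * (c \<bullet> (x $ l))" for l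
      by (intro mult_left_mono p_nonneg recourse_le recourse_min[OF S] vertex x)
    then show "(case v of (z, y, x) \<Rightarrow> (z, y)) \<in> S \<and>
        dro_objective ?T \<mu> q b ?Q (case v of (z, y, x) \<Rightarrow> (z, y)) \<le> ref_objective ?p q b c v"
      by (simp add: v S dro ref_objective_def sum_mono)
  next
    fix w assume "w \<in> S"
    then obtain z y where w: "w = (z, y)" and S: "(z, y) \<in> S"
      by (cases w) auto
    \<comment> \<open>The lift of \<open>(z, y)\<close> collects one recourse minimizer per vertex,
      which gives equal cost.\<close>
    have "\<forall>l. \<exists>x. is_arg_min (\<lambda>x. c \<bullet> x) (\<lambda>x. x \<in> recourse_feasible A B C d z y (\<xi>h l)) x"
      using recourse_min[OF S vertex] by blast
    then obtain x where x:
        "\<And>l. is_arg_min (\<lambda>x. c \<bullet> x) (\<lambda>x. x \<in> recourse_feasible A B C d z y (\<xi>h l)) (x l)"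
      by metis
    have "(z, y, \<chi> l. x l) \<in> ref_feasible S \<xi>h A B C d"
      using S x by (simp add: ref_feasible_def recourse_feasible_def is_arg_min_def)
    moreover have "ref_objective ?p q b c (z, y, \<chi> l. x l) = dro_objective ?T \<mu> q b ?Q w"
      by (simp add: w dro[OF S] ref_objective_def recourse_eq_arg_min[OF x])
    ultimately show "\<exists>v\<in>ref_feasible S \<xi>h A B C d. (case v of (z, y, x) \<Rightarrow> (z, y)) = w \<and>
        ref_objective ?p q b c v = dro_objective ?T \<mu> q b ?Q w"
      by (intro bexI[of _ "(z, y, \<chi> l. x l)"]) (simp_all add: w)
  qed
qed

end
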